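(* Let $\mathcal{H}$ be a pseudohalfplane hypergraph on a finite totally ordered vertex set $V$ with $|V|=n\ge 2$. If every pair of vertices of $V$ is contained in some hyperedge $H\in\mathcal{H}$, then there exist at most $3$ hyperedges of $\mathcal{H}$ whose union is $V$.
   Context: A hypergraph $\mathcal{F}$ on a totally ordered finite vertex set $V$ (a family of subsets of $V$) is ABA-free if there are no two hyperedges $A,B\in\mathcal{F}$ and vertices $x<y<z$ with $x,z\in A\setminus B$ and $y\in B\setminus A$. For a family $\mathcal{F}$ of subsets of $V$ let $\bar{\mathcal{F}}=\{V\setminus F: F\in\mathcal{F}\}$. A hypergraph $\mathcal{H}$ on $V$ is a pseudohalfplane hypergraph if there exists an ABA-free hypergraph $\mathcal{F}$ on $V$ such that $\mathcal{H}\subseteq\mathcal{F}\cup\bar{\mathcal{F}}$. *)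

theory Defs
  imports Main
begin

definition hypergraph_on :: "'a set \<Rightarrow> 'a set set \<Rightarrow> bool" where
  "hypergraph_on V F \<longleftrightarrow> F \<subseteq> Pow V"

definition ABA_free :: "'a::linorder set set \<Rightarrow> bool" where
  "ABA_free F \<longleftrightarrow>
     \<not> (\<exists>A\<in>F. \<exists>B\<in>F. \<exists>x y z. x < y \<and> y < z \<and> x \<in> A - B \<and> z \<in> A - B \<and> y \<in> B - A)"

definition complement_family :: "'a set \<Rightarrow> 'a set set \<Rightarrow> 'a set set" where
  "complement_family V F = {V - A | A. A \<in> F}"

definition pseudohalfplane_hypergraph :: "'a::linorder set \<Rightarrow> 'a set set \<Rightarrow> bool" where
  "pseudohalfplane_hypergraph V H \<longleftrightarrow>
     hypergraph_on V H \<and>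
     (\<exists>F. hypergraph_on V F \<and> ABA_free F \<and> H \<subseteq> F \<union> complement_family V F)"

end

(* Induct on the vertex set by adding a new leftmost vertex l, so that hyperedges A, B, C cover
   everything but l, and each of them has private vertices. Seen from l, the private parts of
   A, B, C come in angular order; let y be a private vertex of the middle one. A hyperedge E
   containing l and y cannot miss private vertices a and c of both outer ones, since in the plane
   the segments ly and ac would cross. Hence E can replace one of the two outer hyperedges. *)
theory Submission
  imports Defs
begin

section \<open>ABA-freeness and complements\<close>

lemma ABA_freeD:
  assumes "ABA_free F" "A \<in> F" "B \<in> F" "x < y" "y < z" "x \<in> A" "x \<notin> B" "z \<in> A" "z \<notin> B" "y \<in> B"
  shows "y \<in> A"
  using assms unfolding ABA_free_def by blast

text \<open>Within \<open>V\<close>, complementation swaps the two differences: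
  \<open>(V - A) - (V - B)\<close> is \<open>B - A\<close>. A forbidden pattern of two complements
  is thus one of the original hyperedges with roles exchanged.\<close>

lemma ABA_free_complement_family:
  assumes "ABA_free F" "hypergraph_on V F"
  shows "ABA_free (complement_family V F)"
  using assms unfolding ABA_free_def hypergraph_on_def complement_family_def by blast

lemma complement_family_involutive:
  assumes "hypergraph_on V F"
  shows "complement_family V (complement_family V F) = F"
proof -
  have "complement_family V (complement_family V F) = (\<lambda>A. V - (V - A)) ` F"
    unfolding complement_family_def by blast
  also have "\<dots> = (\<lambda>A. A) ` F"
    using assms unfolding hypergraph_on_def by (intro image_cong) auto
  finally show ?thesis by simp
qed

section \<open>The crossing argument\<close>

text \<open>Suppose \<open>E\<close> misses \<open>a\<close> and \<open>c\<close>. If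
  \<open>E\<close> is in \<open>F\<close>, then \<open>l\<close>, \<open>b\<close> in
  \<open>E - A\<close> enclose \<open>a\<close> in \<open>A - E\<close>. Otherwise its complement
  contains \<open>a\<close> and \<open>c\<close>, which enclose \<open>b\<close>, a vertex of
  \<open>B\<close> only.\<close>

lemma middle_of_three_up:
  assumes F: "ABA_free F" "A \<in> F" "B \<in> F"
    and E: "E \<in> F \<union> complement_family V F" "l \<in> E" "b \<in> E"
    and ord: "l < a" "a < b" "b < c"
    and mem: "a \<in> A" "a \<notin> B" "b \<in> B" "b \<notin> A" "c \<notin> B" "l \<notin> A" "{a, c} \<subseteq> V"
  shows "a \<in> E \<or> c \<in> E"
proof (cases "E \<in> F")
  case True
  then show ?thesis
    using ABA_freeD[OF F(1) True F(2) ord(1,2)] E mem by blast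
next
  case False
  then obtain M where M: "M \<in> F" "E = V - M"
    using E(1) unfolding complement_family_def by blast
  then show ?thesis
    using ABA_freeD[OF F(1) M(1) F(3) ord(2,3)] E mem by blast
qed

text \<open>Here \<open>N\<close> will be the complement of the third hyperedge. The new case is
  \<open>c < b\<close> with \<open>E = V - M\<close>: then \<open>l\<close>, \<open>b\<close> in
  \<open>N - M\<close> enclose \<open>c\<close> in \<open>M - N\<close>.\<close>

lemma middle_of_two_up_one_down:
  assumes F: "ABA_free F" "A \<in> F" "B \<in> F" "N \<in> F"
    and E: "E \<in> F \<union> complement_family V F" "l \<in> E" "b \<in> E"
    and ord: "l < a" "a < b" "l < c"
    and mem: "a \<in> A" "a \<notin> B" "b \<in> B" "b \<notin> A" "c \<notin> B" "l \<notin> A" "{a, c} \<subseteq> V"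
      "l \<in> N" "b \<in> N" "c \<notin> N"
  shows "a \<in> E \<or> c \<in> E"
proof (cases "E \<in> F")
  case True
  then show ?thesis
    using ABA_freeD[OF F(1) True F(2) ord(1,2)] E mem by blast
next
  case False
  then obtain M where M: "M \<in> F" "E = V - M"
    using E(1) unfolding complement_family_def by blast
  consider "b < c" | "c < b"
    using mem(9,10) by (metis linorder_neqE)
  then show ?thesis
  proof cases
    case 1
    then show ?thesis
      using ABA_freeD[OF F(1) M(1) F(3) ord(2) 1] M E mem by blast
  next
    case 2
    then show ?thesis
      using ABA_freeD[OF F(1,4) M(1) ord(3) 2] M E mem by blast
  qed
qed

text \<open>If \<open>y < x'\<close>, then \<open>x < y < x'\<close> is a forbidden pattern. So the
  side on which one private vertex lies decides the side of all others.\<close>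

lemma private_vertices_separated:
  assumes "ABA_free F" "A \<in> F" "B \<in> F" "x \<in> A - B" "x' \<in> A - B" "y \<in> B - A" "x < y"
  shows "x' < y"
  using assms ABA_freeD[of F A B x y x'] by (metis DiffE linorder_neqE)

section \<open>Replacing one hyperedge of a cover\<close>

definition extends_cover :: "'a set \<Rightarrow> 'a set \<Rightarrow> 'a set \<Rightarrow> 'a set \<Rightarrow> 'a set \<Rightarrow> bool" where
  "extends_cover W A B C E \<longleftrightarrow> W \<subseteq> E \<union> A \<union> B \<or> W \<subseteq> E \<union> A \<union> C \<or> W \<subseteq> E \<union> B \<union> C"

lemma extends_cover_permute:
  "extends_cover W A B C = extends_cover W A C B"
  "extends_cover W A B C = extends_cover W B A C"
  unfolding extends_cover_def by blast+

lemma opposite_vertex_three_up: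
  assumes F: "ABA_free F" "A \<in> F" "B \<in> F" "C \<in> F"
    and W: "W \<subseteq> V" "\<forall>w\<in>W. l < w" "W \<subseteq> A \<union> B \<union> C" "l \<notin> A \<union> B \<union> C"
    and p: "a \<in> W \<inter> A - (B \<union> C)" "b \<in> W \<inter> B - (A \<union> C)" "c \<in> W \<inter> C - (A \<union> B)"
      "a < b" "b < c"
    and E: "E \<in> F \<union> complement_family V F" "l \<in> E" "b \<in> E"
  shows "extends_cover W A B C E"
proof (rule ccontr)
  assume "\<not> ?thesis"
  \<comment> \<open>A vertex of \<open>W\<close> missed by \<open>E\<close>, \<open>B\<close> and
    \<open>C\<close> lies in \<open>A\<close> alone; likewise \<open>c'\<close> comes from the
    failure of \<open>E\<close>, \<open>A\<close>, \<open>B\<close>.\<close>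
  then obtain a' c' where p': "a' \<in> W \<inter> A - (B \<union> C)" "a' \<notin> E" "c' \<in> W \<inter> C - (A \<union> B)" "c' \<notin> E"
    using W(3) unfolding extends_cover_def by blast
  have "a' < b"
    using private_vertices_separated[OF F(1-3), of a a' b] p p' by blast
  moreover have "\<not> c' < b"
    using private_vertices_separated[OF F(1,4,3), of c' c b] p p' by fastforce
  moreover have "c' \<noteq> b"
    using p p' by blast
  ultimately show False
    using middle_of_three_up[OF F(1-3) E, of a' c'] p p' W by force
qed

text \<open>Seen from \<open>l\<close>, the private part of the downward hyperedge \<open>C\<close>
  comes last in angular order, wherever it lies relative to \<open>b\<close>. The complement
  \<open>N\<close> of \<open>C\<close> contains \<open>l\<close> and \<open>b\<close> but not
  \<open>c'\<close>.\<close>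

lemma opposite_vertex_two_up_one_down:
  assumes F: "ABA_free F" "A \<in> F" "B \<in> F" "C \<in> complement_family V F"
    and W: "W \<subseteq> V" "l \<in> V" "\<forall>w\<in>W. l < w" "W \<subseteq> A \<union> B \<union> C" "l \<notin> A \<union> B \<union> C"
    and p: "a \<in> W \<inter> A - (B \<union> C)" "b \<in> W \<inter> B - (A \<union> C)" "a < b"
    and E: "E \<in> F \<union> complement_family V F" "l \<in> E" "b \<in> E"
  shows "extends_cover W A B C E"
proof (rule ccontr)
  assume "\<not> ?thesis"
  then obtain a' c' where p': "a' \<in> W \<inter> A - (B \<union> C)" "a' \<notin> E" "c' \<in> W \<inter> C - (A \<union> B)" "c' \<notin> E"
    using W(4) unfolding extends_cover_def by blast
  obtain N where N: "N \<in> F" "C = V - N"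
    using F(4) unfolding complement_family_def by blast
  have "a' < b"
    using private_vertices_separated[OF F(1-3), of a a' b] p p' by blast
  then show False
    using middle_of_two_up_one_down[OF F(1-3) N(1) E, of a' c'] N(2) p p' W by blast
qed

text \<open>The vertex \<open>y\<close> is chosen before \<open>E\<close>, because the pair
  condition later supplies \<open>E\<close> from \<open>l\<close> and \<open>y\<close>.\<close>

lemma opposite_vertex_aux:
  assumes F: "ABA_free F" "A \<in> F" "B \<in> F" "C \<in> F \<union> complement_family V F"
    and W: "W \<subseteq> V" "l \<in> V" "\<forall>w\<in>W. l < w" "W \<subseteq> A \<union> B \<union> C" "l \<notin> A \<union> B \<union> C"
    and z: "z \<in> V - {l}"
  shows "\<exists>y\<in>V - {l}. \<forall>E\<in>F \<union> complement_family V F.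
    l \<in> E \<longrightarrow> y \<in> E \<longrightarrow> extends_cover W A B C E"
proof (cases "\<forall>E. extends_cover W A B C E")
  case True
  \<comment> \<open>Any vertex other than \<open>l\<close> serves; \<open>z\<close> is the
    default.\<close>
  then show ?thesis using z by blast
next
  case False
  \<comment> \<open>Some \<open>E\<close> fails, so no two of \<open>A\<close>, \<open>B\<close>,
    \<open>C\<close> cover \<open>W\<close>, and each has a private vertex there.\<close>
  then obtain a b c where p: "a \<in> W \<inter> A - (B \<union> C)" "b \<in> W \<inter> B - (A \<union> C)" "c \<in> W \<inter> C - (A \<union> B)"
    using W(4) unfolding extends_cover_def by blast
  have in_V: "a \<in> V - {l}" "b \<in> V - {l}" "c \<in> V - {l}"
    using p W by auto
  have ne: "a \<noteq> b" "b \<noteq> c" "a \<noteq> c"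
    using p by auto
  show ?thesis
  proof (cases "C \<in> F")
    case True
    note up = F(1-3) True
    \<comment> \<open>With all three in \<open>F\<close>, angular order is the order of the
      vertices; \<open>y\<close> is the middle one in each case.\<close>
    consider "a < b" "b < c" | "c < b" "b < a" | "b < a" "a < c" | "c < a" "a < b"
      | "a < c" "c < b" | "b < c" "c < a"
      using ne by (metis linorder_neqE)
    then show ?thesis
    proof cases
      case 1
      have "extends_cover W A B C E" if "E \<in> F \<union> complement_family V F" "l \<in> E" "b \<in> E" for E
        by (rule opposite_vertex_three_up[of F A B C W V l a b c]) (use up W p 1 that in auto)
      then show ?thesis using in_V by blast
    next
      case 2
      have "extends_cover W C B A E" if "E \<in> F \<union> complement_family V F" "l \<in> E" "b \<in> E" for E
        by (rule opposite_vertex_three_up[of F C B A W V l c b a]) (use up W p 2 that in auto)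
      then show ?thesis using in_V extends_cover_permute by metis
    next
      case 3
      have "extends_cover W B A C E" if "E \<in> F \<union> complement_family V F" "l \<in> E" "a \<in> E" for E
        by (rule opposite_vertex_three_up[of F B A C W V l b a c]) (use up W p 3 that in auto)
      then show ?thesis using in_V extends_cover_permute by metis
    next
      case 4
      have "extends_cover W C A B E" if "E \<in> F \<union> complement_family V F" "l \<in> E" "a \<in> E" for E
        by (rule opposite_vertex_three_up[of F C A B W V l c a b]) (use up W p 4 that in auto)
      then show ?thesis using in_V extends_cover_permute by metis
    next
      case 5
      have "extends_cover W A C B E" if "E \<in> F \<union> complement_family V F" "l \<in> E" "c \<in> E" for E
        by (rule opposite_vertex_three_up[of F A C B W V l a c b]) (use up W p 5 that in auto)
      then show ?thesis using in_V extends_cover_permute by metis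
    next
      case 6
      have "extends_cover W B C A E" if "E \<in> F \<union> complement_family V F" "l \<in> E" "c \<in> E" for E
        by (rule opposite_vertex_three_up[of F B C A W V l b c a]) (use up W p 6 that in auto)
      then show ?thesis using in_V extends_cover_permute by metis
    qed
  next
    case False
    then have down: "C \<in> complement_family V F"
      using F(4) by blast
    \<comment> \<open>The right one of \<open>a\<close> and \<open>b\<close> belongs to the middle
      hyperedge.\<close>
    consider "a < b" | "b < a"
      using ne by (metis linorder_neqE)
    then show ?thesis
    proof cases
      case 1
      have "extends_cover W A B C E" if "E \<in> F \<union> complement_family V F" "l \<in> E" "b \<in> E" for E
        by (rule opposite_vertex_two_up_one_down[of F A B C V W l a b])
          (use F(1-3) down W p 1 that in auto)
      then show ?thesis using in_V by blast
    next
      case 2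
      have "extends_cover W B A C E" if "E \<in> F \<union> complement_family V F" "l \<in> E" "a \<in> E" for E
        by (rule opposite_vertex_two_up_one_down[of F B A C V W l b a])
          (use F(1-3) down W p 2 that in auto)
      then show ?thesis using in_V extends_cover_permute by metis
    qed
  qed
qed

text \<open>By pigeonhole two of the three hyperedges lie in \<open>F\<close> or two lie in its
  complement family. Exchanging these families preserves ABA-freeness and their union.\<close>

lemma opposite_vertex:
  assumes F: "ABA_free F" "hypergraph_on V F"
    and ABC: "{A, B, C} \<subseteq> F \<union> complement_family V F"
    and W: "W \<subseteq> V" "l \<in> V" "\<forall>w\<in>W. l < w" "W \<subseteq> A \<union> B \<union> C" "l \<notin> A \<union> B \<union> C"
    and z: "z \<in> V - {l}"
  shows "\<exists>y\<in>V - {l}. \<forall>E\<in>F \<union> complement_family V F.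
    l \<in> E \<longrightarrow> y \<in> E \<longrightarrow> extends_cover W A B C E"
proof -
  have two_alike: ?thesis
    if G: "ABA_free G" "F \<union> complement_family V F = G \<union> complement_family V G"
      and two: "A \<in> G \<and> B \<in> G \<or> A \<in> G \<and> C \<in> G \<or> B \<in> G \<and> C \<in> G" for G
    using two
  proof (elim disjE conjE)
    assume "A \<in> G" "B \<in> G"
    then show ?thesis
      using opposite_vertex_aux[of G A B C V W l z] G ABC W z by auto
  next
    assume "A \<in> G" "C \<in> G"
    moreover have "W \<subseteq> A \<union> C \<union> B" using W by blast
    ultimately show ?thesis
      using opposite_vertex_aux[of G A C B V W l z] G ABC W z
      by (auto simp: extends_cover_permute(1)[of W A C B])
  next
    assume "B \<in> G" "C \<in> G"
    moreover have "W \<subseteq> B \<union> C \<union> A" using W by blast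
    moreover have "extends_cover W B C A = extends_cover W A B C"
      by (metis extends_cover_permute)
    ultimately show ?thesis
      using opposite_vertex_aux[of G B C A V W l z] G ABC W z by auto
  qed
  consider "A \<in> F \<and> B \<in> F \<or> A \<in> F \<and> C \<in> F \<or> B \<in> F \<and> C \<in> F"
    | "A \<in> complement_family V F \<and> B \<in> complement_family V F
        \<or> A \<in> complement_family V F \<and> C \<in> complement_family V F
        \<or> B \<in> complement_family V F \<and> C \<in> complement_family V F"
    using ABC by blast
  then show ?thesis
  proof cases
    case 1
    then show ?thesis using two_alike[of F] F by blast
  next
    case 2
    have "F \<union> complement_family V F
        = complement_family V F \<union> complement_family V (complement_family V F)"
      using complement_family_involutive[OF F(2)] by blast
    then show ?thesis
      using two_alike[of "complement_family V F"] ABA_free_complement_family[OF F] 2 by blast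
  qed
qed

section \<open>Induction from right to left\<close>

text \<open>Only \<open>W\<close> varies in the induction; \<open>V\<close> stays fixed, since pairs
  and complements refer to it. The vertices \<open>u\<close>, \<open>v\<close> provide a hyperedge
  for empty \<open>W\<close> and a vertex \<open>z\<close> other than \<open>l\<close>.\<close>

lemma three_hyperedges_cover_subset:
  fixes V :: "'a::linorder set"
  assumes F: "ABA_free F" "hypergraph_on V F" "H \<subseteq> F \<union> complement_family V F"
    and pairs: "\<forall>x\<in>V. \<forall>y\<in>V. x \<noteq> y \<longrightarrow> (\<exists>A\<in>H. x \<in> A \<and> y \<in> A)"
    and two: "u \<in> V" "v \<in> V" "u \<noteq> v"
    and W: "finite W" "W \<subseteq> V"
  shows "\<exists>A\<in>H. \<exists>B\<in>H. \<exists>C\<in>H. W \<subseteq> A \<union> B \<union> C"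
  using W
proof (induction W rule: finite_linorder_min_induct)
  case empty
  obtain A where "A \<in> H"
    using pairs two by blast
  then show ?case by blast
next
  case (insert l W)
  then obtain A B C where ABC: "A \<in> H" "B \<in> H" "C \<in> H" "W \<subseteq> A \<union> B \<union> C"
    by blast
  show ?case
  proof (cases "l \<in> A \<union> B \<union> C")
    case True
    then have "insert l W \<subseteq> A \<union> B \<union> C" using ABC by blast
    then show ?thesis using ABC by blast
  next
    case False
    obtain z where z: "z \<in> V - {l}"
      using two by blast
    have "{A, B, C} \<subseteq> F \<union> complement_family V F"
      using F(3) ABC(1-3) by blast
    moreover have "W \<subseteq> V" "l \<in> V" "\<forall>w\<in>W. l < w"
      using insert.hyps insert.prems by auto
    ultimately obtain y where y: "y \<in> V - {l}"
      "\<forall>E\<in>F \<union> complement_family V F. l \<in> E \<longrightarrow> y \<in> E \<longrightarrow> extends_cover W A B C E"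
      using opposite_vertex[OF F(1,2) _ _ _ _ ABC(4) False z] by blast
    \<comment> \<open>Since \<open>y\<close> differs from \<open>l\<close>, the pair condition
      applies to them.\<close>
    obtain E where E: "E \<in> H" "l \<in> E" "y \<in> E"
      using pairs y(1) insert.prems by blast
    then have "extends_cover W A B C E"
      using y(2) F(3) by blast
    then have "insert l W \<subseteq> E \<union> A \<union> B \<or> insert l W \<subseteq> E \<union> A \<union> C \<or> insert l W \<subseteq> E \<union> B \<union> C"
      using E(2) unfolding extends_cover_def by blast
    then show ?thesis using E(1) ABC(1-3) by metis
  qed
qed

theorem mainTheorem6:
  fixes V :: "'a::linorder set" and H :: "'a set set"
  assumes "finite V"
    and "card V \<ge> 2"
    and "pseudohalfplane_hypergraph V H"
    and "\<forall>x\<in>V. \<forall>y\<in>V. x \<noteq> y \<longrightarrow> (\<exists>A\<in>H. x \<in> A \<and> y \<in> A)"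
  shows "\<exists>S. S \<subseteq> H \<and> finite S \<and> card S \<le> 3 \<and> \<Union>S = V"
proof -
  obtain F where F: "hypergraph_on V F" "ABA_free F" "H \<subseteq> F \<union> complement_family V F"
    and H: "H \<subseteq> Pow V"
    using assms(3) unfolding pseudohalfplane_hypergraph_def hypergraph_on_def by blast
  obtain u v where "u \<in> V" "v \<in> V" "u \<noteq> v"
    using assms(2) by (metis card_le_Suc0_iff_eq assms(1) not_less_eq_eq numeral_2_eq_2)
  then obtain A B C where ABC: "A \<in> H" "B \<in> H" "C \<in> H" "V \<subseteq> A \<union> B \<union> C"
    using three_hyperedges_cover_subset[OF F(2,1,3) assms(4) _ _ _ assms(1) subset_refl] by blast
  \<comment> \<open>The three hyperedges may coincide, hence only a bound.\<close>
  have "card {A, B, C} \<le> 3"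
    by (simp add: card_insert_if)
  moreover have "\<Union>{A, B, C} = V"
    using ABC(4) H[THEN subsetD, OF ABC(1)] H[THEN subsetD, OF ABC(2)] H[THEN subsetD, OF ABC(3)]
    by auto
  ultimately show ?thesis
    using ABC by (intro exI[of _ "{A, B, C}"]) auto
qed

end
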